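(* Let $\mathbf a_{\mathrm{Id}}=\{\Delta_1,\dots,\Delta_n\}$ be a symmetric multisegment with $b(\Delta_1)<\cdots<b(\Delta_n)$ and $e(\Delta_1)<\cdots<e(\Delta_n)$. Then the formula $$\Phi(w)=\sum_{i=1}^n[\,b(\Delta_i),e(\Delta_{w(i)})\,]\qquad(w\in S_n)$$ defines a bijection between the symmetric group $S_n$ and $S(\mathbf a_{\mathrm{Id}})$. Moreover the order relation on $S(\mathbf a_{\mathrm{Id}})$ induces the inverse Bruhat order: for $w,v\in S_n$, $$w\le v\iff\Phi(w)\ge\Phi(v),$$ where $\le$ on $S_n$ is the Bruhat order.
   Context: A segment is a set $\Delta=[i,j]=\{i,\dots,j\}$ with $i\le j$ integers; $b(\Delta)=i$, $e(\Delta)=j$. A multisegment is a finite multiset of segments (written also as a formal sum). Two segments are linked if their union is a segment different from both. An elementary operation replaces a linked pair $\Delta,\Delta'$ of segments of a multisegment by $\Delta\cup\Delta'$ and $\Delta\cap\Delta'$ (omitted if empty). $\mathbf b\le\mathbf a$ means $\mathbf b$ is obtained from $\mathbf a$ by a (possibly empty) sequence of elementary operations; $S(\mathbf a)=\{\mathbf b:\mathbf b\le\mathbf a\}$. A multisegment $\{\Delta_1,\dots,\Delta_n\}$ is symmetric if the $b(\Delta_i)$ are pairwise distinct, the $e(\Delta_i)$ are pairwise distinct, and $\max_i b(\Delta_i)\le\min_i e(\Delta_i)$. *)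

theory Defs
  imports "HOL-Combinatorics.Permutations" "HOL-Library.Multiset"
begin

text \<open>A segment is a nonempty integer interval, kept as a set, so that the union and
  intersection of segments are those of sets.\<close>

definition is_segment :: "int set \<Rightarrow> bool" where
  "is_segment D \<longleftrightarrow> (\<exists>i j. i \<le> j \<and> D = {i..j})"

definition seg_begin :: "int set \<Rightarrow> int" where
  "seg_begin D = Min D"

definition seg_end :: "int set \<Rightarrow> int" where
  "seg_end D = Max D"

definition is_multisegment :: "int set multiset \<Rightarrow> bool" where
  "is_multisegment a \<longleftrightarrow> (\<forall>D \<in># a. is_segment D)"

definition linked :: "int set \<Rightarrow> int set \<Rightarrow> bool" where
  "linked D D' \<longleftrightarrow> is_segment D \<and> is_segment D' \<and>
     is_segment (D \<union> D') \<and> D \<union> D' \<noteq> D \<and> D \<union> D' \<noteq> D'"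

definition elementary_op :: "int set multiset \<Rightarrow> int set multiset \<Rightarrow> bool" where
  "elementary_op a b \<longleftrightarrow> (\<exists>D D'. {#D, D'#} \<subseteq># a \<and> linked D D' \<and>
     b = a - {#D, D'#} + {#D \<union> D'#} + (if D \<inter> D' = {} then {#} else {#D \<inter> D'#}))"

definition mseg_le :: "int set multiset \<Rightarrow> int set multiset \<Rightarrow> bool" where
  "mseg_le b a \<longleftrightarrow> elementary_op\<^sup>*\<^sup>* a b"

definition mseg_below :: "int set multiset \<Rightarrow> int set multiset set" where
  "mseg_below a = {b. mseg_le b a}"

text \<open>Pairwise distinctness is over the members of the multiset with multiplicity, hence
  a bound on counts. The guard in the last conjunct makes the empty multisegment
  symmetric, where the maximum and the minimum do not exist.\<close>

definition symmetric_mseg :: "int set multiset \<Rightarrow> bool" where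
  "symmetric_mseg a \<longleftrightarrow> is_multisegment a \<and>
     (\<forall>x. count (image_mset seg_begin a) x \<le> 1) \<and>
     (\<forall>x. count (image_mset seg_end a) x \<le> 1) \<and>
     (a \<noteq> {#} \<longrightarrow> Max (seg_begin ` set_mset a) \<le> Min (seg_end ` set_mset a))"

definition mseg_of :: "nat \<Rightarrow> (nat \<Rightarrow> int set) \<Rightarrow> int set multiset" where
  "mseg_of n \<Delta> = (\<Sum>i = 1..n. {#\<Delta> i#})"

definition Phi :: "nat \<Rightarrow> (nat \<Rightarrow> int set) \<Rightarrow> (nat \<Rightarrow> nat) \<Rightarrow> int set multiset" where
  "Phi n \<Delta> w = (\<Sum>i = 1..n. {#{seg_begin (\<Delta> i)..seg_end (\<Delta> (w i))}#})"

text \<open>The Bruhat order on the permutations of \<open>{1..n}\<close>: the reflexive transitive closure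
  of the relation between \<open>u\<close> and \<open>u t\<close> with \<open>t\<close> a reflection, that is a transposition, which
  increases the length; the length is the number of inversions.\<close>

definition perm_length :: "nat \<Rightarrow> (nat \<Rightarrow> nat) \<Rightarrow> nat" where
  "perm_length n w = card {(i, j). 1 \<le> i \<and> i < j \<and> j \<le> n \<and> w j < w i}"

definition bruhat_step :: "nat \<Rightarrow> (nat \<Rightarrow> nat) \<Rightarrow> (nat \<Rightarrow> nat) \<Rightarrow> bool" where
  "bruhat_step n u v \<longleftrightarrow> u permutes {1..n} \<and>
     (\<exists>i j. 1 \<le> i \<and> i < j \<and> j \<le> n \<and> v = u \<circ> transpose i j) \<and>
     perm_length n u < perm_length n v"

definition bruhat_le :: "nat \<Rightarrow> (nat \<Rightarrow> nat) \<Rightarrow> (nat \<Rightarrow> nat) \<Rightarrow> bool" where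
  "bruhat_le n = (bruhat_step n)\<^sup>*\<^sup>*"

end

theory Submission
  imports Defs
begin

text \<open>Write \<open>b i\<close> and \<open>e i\<close> for the ends of the \<open>i\<close>-th segment. Since every begin lies below every
  end, for \<open>i < j\<close> the segments \<open>[b i, e (w i)]\<close> and \<open>[b j, e (w j)]\<close> are linked exactly when
  \<open>w i < w j\<close>, and the elementary operation exchanges their ends: it turns \<open>\<Phi> w\<close> into
  \<open>\<Phi> (w \<circ> (i j))\<close>. As \<open>w i < w j\<close> is also the condition for \<open>w \<circ> (i j)\<close> to be longer than \<open>w\<close>,
  elementary operations on \<open>\<Phi> w\<close> are the same as Bruhat steps from \<open>w\<close>. Surjectivity then amounts
  to the identity being the least element of the Bruhat order.\<close>

section \<open>Length and the Bruhat order on permutations\<close>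

definition inversions :: "nat \<Rightarrow> (nat \<Rightarrow> nat) \<Rightarrow> (nat \<times> nat) set" where
  "inversions n w = {(i, j). 1 \<le> i \<and> i < j \<and> j \<le> n \<and> w j < w i}"

lemma perm_length_eq_card_inversions: "perm_length n w = card (inversions n w)"
  by (simp add: perm_length_def inversions_def)

lemma finite_inversions: "finite (inversions n w)"
  by (rule finite_subset[of _ "{1..n} \<times> {1..n}"]) (auto simp: inversions_def)

text \<open>The inversions of \<open>u\<close> inject into those of
  \<open>u \<circ> transpose i j\<close>, and the image misses the new inversion
  \<open>(i, j)\<close>.\<close>

lemma perm_length_transpose_less:
  assumes "1 \<le> i" "i < j" "j \<le> n" "u i < u j"
  shows "perm_length n u < perm_length n (u \<circ> transpose i j)"
proof -
  let ?t = "transpose i j"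
  \<comment> \<open>A pair whose order \<open>?t\<close> reverses is left in place: apart from
    \<open>(i, j)\<close>, which is not an inversion of \<open>u\<close>, such a pair joins
    \<open>i\<close> or \<open>j\<close> to a position strictly between them, and
    \<open>u i < u j\<close> keeps it an inversion. The case test also makes \<open>f\<close>
    injective, since \<open>?t\<close> is an involution and so a moved pair never equals an unmoved
    one.\<close>
  define f where "f = (\<lambda>(p, q). if ?t p < ?t q then (?t p, ?t q) else (p, q))"
  have inj: "inj_on f (inversions n u)"
  proof (rule inj_onI)
    fix x y
    assume "x \<in> inversions n u" "y \<in> inversions n u" "f x = f y"
    then show "x = y"
      by (cases x; cases y)
        (auto simp: f_def inversions_def dest: transpose_eq_imp_eq split: if_splits)
  qed
  have sub: "f x \<in> inversions n (u \<circ> ?t) - {(i, j)}" if "x \<in> inversions n u" for x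
  proof -
    obtain p q where x: "x = (p, q)" "1 \<le> p" "p < q" "q \<le> n" "u q < u p"
      using \<open>x \<in> inversions n u\<close> by (auto simp: inversions_def)
    show ?thesis
      using x assms
      by (cases "p = i"; cases "p = j"; cases "q = i"; cases "q = j")
        (simp_all add: f_def inversions_def)
  qed
  have "card (inversions n u) \<le> card (inversions n (u \<circ> ?t) - {(i, j)})"
    by (intro card_inj_on_le[OF inj] image_subsetI sub finite_Diff finite_inversions)
  also have "\<dots> < card (inversions n (u \<circ> ?t))"
    using assms by (intro card_Diff1_less finite_inversions) (auto simp: inversions_def)
  finally show ?thesis by (simp add: perm_length_eq_card_inversions)
qed

text \<open>For the converse, \<open>u i > u j\<close> would let the previous lemma apply to
  \<open>u \<circ> transpose i j\<close>, whose exchange gives back \<open>u\<close>, and yield the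
  opposite inequality.\<close>

lemma perm_length_transpose_less_iff:
  assumes "u permutes {1..n}" "1 \<le> i" "i < j" "j \<le> n"
  shows "perm_length n u < perm_length n (u \<circ> transpose i j) \<longleftrightarrow> u i < u j"
proof
  assume less: "perm_length n u < perm_length n (u \<circ> transpose i j)"
  show "u i < u j"
  proof (rule ccontr)
    assume "\<not> u i < u j"
    moreover have "u i \<noteq> u j"
      using permutes_inj[OF assms(1)] assms(3) by (auto dest: injD)
    ultimately have "perm_length n (u \<circ> transpose i j)
        < perm_length n (u \<circ> transpose i j \<circ> transpose i j)"
      using assms by (intro perm_length_transpose_less) auto
    with less show False by (simp add: comp_assoc)
  qed
qed (use assms perm_length_transpose_less in auto)

lemma bruhat_step_iff:
  assumes "u permutes {1..n}"
  shows "bruhat_step n u v \<longleftrightarrow>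
    (\<exists>i j. 1 \<le> i \<and> i < j \<and> j \<le> n \<and> u i < u j \<and> v = u \<circ> transpose i j)"
  using assms perm_length_transpose_less_iff[OF assms] by (auto simp: bruhat_step_def)

lemma bruhat_step_permutes: "bruhat_step n u v \<Longrightarrow> v permutes {1..n}"
  unfolding bruhat_step_def by (auto intro!: permutes_compose permutes_swap_id)

lemma bruhat_le_permutes: "bruhat_le n u v \<Longrightarrow> u permutes {1..n} \<Longrightarrow> v permutes {1..n}"
  unfolding bruhat_le_def by (induction rule: rtranclp_induct) (blast intro: bruhat_step_permutes)+

text \<open>Without inversions \<open>w\<close> is increasing, so its list of values is strictly
  sorted with the same elements as \<open>[1..<Suc n]\<close>; a strictly sorted list is determined
  by its set.\<close>

lemma permutes_no_inversions_eq_id: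
  assumes w: "w permutes {1..n}" and "inversions n w = {}"
  shows "w = id"
proof -
  have mono: "w i < w j" if "i \<in> {1..n}" "j \<in> {1..n}" "i < j" for i j
    using assms(2) that permutes_inj[OF w, THEN injD, of i j]
    by (force simp: inversions_def not_less)
  have "map w [1..<Suc n] = [1..<Suc n]"
  proof (rule strict_sorted_equal)
    show "sorted_wrt (<) (map w [1..<Suc n])"
      unfolding sorted_wrt_map
      by (rule sorted_wrt_mono_rel[OF _ sorted_wrt_upt]) (auto intro!: mono simp del: upt_Suc)
    show "set (map w [1..<Suc n]) = set [1..<Suc n]"
      using permutes_image[OF w] by (simp add: atLeastLessThanSuc_atLeastAtMost del: upt_Suc)
  qed (simp only: sorted_wrt_upt)
  then have "w i = i" if "i \<in> {1..n}" for i
    using that map_eq_conv[of w "[1..<Suc n]" id] by (auto simp del: upt_Suc)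
  then show ?thesis using permutes_not_in[OF w] by (intro ext) (metis id_apply)
qed

text \<open>Exchanging the two positions of an inversion of \<open>w\<close> gives a shorter
  permutation from which \<open>w\<close> is one Bruhat step; induction on length ends at the only
  permutation without inversions.\<close>

lemma bruhat_le_id:
  assumes "w permutes {1..n}"
  shows "bruhat_le n id w"
  using assms
proof (induction "perm_length n w" arbitrary: w rule: less_induct)
  case less
  show ?case
  proof (cases "inversions n w = {}")
    case True
    with less.prems show ?thesis
      using permutes_no_inversions_eq_id by (auto simp: bruhat_le_def)
  next
    case False
    then obtain i j where ij: "1 \<le> i" "i < j" "j \<le> n" "w j < w i"
      by (auto simp: inversions_def)
    let ?u = "w \<circ> transpose i j"
    have u: "?u permutes {1..n}"
      using less.prems ij by (auto intro!: permutes_compose permutes_swap_id)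
    have w: "w = ?u \<circ> transpose i j" by (simp add: comp_assoc)
    have "?u i < ?u j" using ij by simp
    with u ij w have step: "bruhat_step n ?u w"
      by (subst bruhat_step_iff) blast+
    then have "perm_length n ?u < perm_length n w" by (simp add: bruhat_step_def)
    with less.hyps u have "bruhat_le n id ?u" by blast
    with step show ?thesis unfolding bruhat_le_def by simp
  qed
qed

section \<open>Linkedness of overlapping intervals\<close>

lemma linked_atLeastAtMost_iff:
  assumes "b < b'" "b \<le> e" "b' \<le> e" "b' \<le> (e' :: int)"
  shows "linked {b..e} {b'..e'} \<longleftrightarrow> e < e'"
proof
  assume "linked {b..e} {b'..e'}"
  then have "\<not> {b'..e'} \<subseteq> {b..e}" by (auto simp: linked_def)
  with assms show "e < e'" by auto
next
  assume "e < e'"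
  with assms have "{b..e} \<union> {b'..e'} = {b..e'}" by auto
  \<comment> \<open>The points \<open>b\<close> and \<open>e'\<close> of the union witness that it
    differs from the second and from the first interval respectively.\<close>
  moreover have "b \<in> {b..e'}" "b \<notin> {b'..e'}" "e' \<in> {b..e'}" "e' \<notin> {b..e}"
    using assms \<open>e < e'\<close> by auto
  ultimately show "linked {b..e} {b'..e'}"
    using assms unfolding linked_def is_segment_def by (metis order.trans less_imp_le)
qed

lemma linked_sym: "linked D D' \<longleftrightarrow> linked D' D"
  by (auto simp: linked_def Un_commute)

section \<open>Multisegments built from the ends of a symmetric family\<close>

locale symmetric_family =
  fixes n :: nat and b e :: "nat \<Rightarrow> int"
  assumes strict_mono_b: "strict_mono_on {1..n} b"
    and strict_mono_e: "strict_mono_on {1..n} e"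
    and b_le_e: "i \<in> {1..n} \<Longrightarrow> j \<in> {1..n} \<Longrightarrow> b i \<le> e j"
begin

text \<open>This is \<open>Phi\<close> expressed through the ends alone, as an image of
  \<open>mset_set\<close> so that chosen indices can be split off; \<open>segs id\<close> is the
  initial multisegment.\<close>

definition segs :: "(nat \<Rightarrow> nat) \<Rightarrow> int set multiset" where
  "segs w = image_mset (\<lambda>i. {b i..e (w i)}) (mset_set {1..n})"

lemma segs_split:
  assumes "i \<in> {1..n}" "j \<in> {1..n}" "i \<noteq> j"
  shows "segs w = {#{b i..e (w i)}, {b j..e (w j)}#}
    + image_mset (\<lambda>i. {b i..e (w i)}) (mset_set ({1..n} - {i, j}))"
proof -
  have "{1..n} = insert i (insert j ({1..n} - {i, j}))" using assms by auto
  then have "mset_set {1..n} = mset_set (insert i (insert j ({1..n} - {i, j})))" by simp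
  also have "\<dots> = {#i, j#} + mset_set ({1..n} - {i, j})"
    using assms by (subst mset_set.insert; simp)
  finally show ?thesis by (simp add: segs_def)
qed

text \<open>Since \<open>b j \<le> e (w i)\<close>, the two segments meet, so the intersection is
  never omitted; union and intersection keep the begins and swap the ends.\<close>

lemma segs_exchange:
  assumes w: "w permutes {1..n}" and ij: "i \<in> {1..n}" "j \<in> {1..n}" "i < j" "w i < w j"
  defines "D \<equiv> {b i..e (w i)}" and "D' \<equiv> {b j..e (w j)}"
  shows "segs w - {#D, D'#} + {#D \<union> D'#} + (if D \<inter> D' = {} then {#} else {#D \<inter> D'#})
    = segs (w \<circ> transpose i j)"
proof -
  have wij: "w i \<in> {1..n}" "w j \<in> {1..n}" using w ij permutes_in_image by metis+
  have "b i < b j" "e (w i) < e (w j)"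
    using strict_mono_onD[OF strict_mono_b] strict_mono_onD[OF strict_mono_e] ij wij by auto
  moreover have "b j \<le> e (w i)" using b_le_e ij wij by blast
  ultimately have "D \<union> D' = {b i..e (w j)}" "D \<inter> D' = {b j..e (w i)}" "D \<inter> D' \<noteq> {}"
    unfolding D_def D'_def by auto
  moreover have "image_mset (\<lambda>k. {b k..e ((w \<circ> transpose i j) k)}) (mset_set ({1..n} - {i, j}))
      = image_mset (\<lambda>k. {b k..e (w k)}) (mset_set ({1..n} - {i, j}))"
    by (intro image_mset_cong) auto
  ultimately show ?thesis
    using ij segs_split[of i j w] segs_split[of i j "w \<circ> transpose i j"]
    by (simp add: D_def D'_def)
qed

lemma linked_iff:
  assumes w: "w permutes {1..n}" and ij: "i \<in> {1..n}" "j \<in> {1..n}" "i < j"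
  shows "linked {b i..e (w i)} {b j..e (w j)} \<longleftrightarrow> w i < w j"
proof -
  have wij: "w i \<in> {1..n}" "w j \<in> {1..n}" using w ij permutes_in_image by metis+
  have "b i < b j" using strict_mono_onD[OF strict_mono_b] ij by auto
  then have "linked {b i..e (w i)} {b j..e (w j)} \<longleftrightarrow> e (w i) < e (w j)"
    using b_le_e ij wij by (intro linked_atLeastAtMost_iff) auto
  also have "\<dots> \<longleftrightarrow> w i < w j"
    using strict_mono_on_less[OF strict_mono_e] wij by auto
  finally show ?thesis .
qed

lemma elementary_op_segs_iff:
  assumes w: "w permutes {1..n}"
  shows "elementary_op (segs w) x \<longleftrightarrow> (\<exists>v. bruhat_step n w v \<and> x = segs v)"
proof
  assume "elementary_op (segs w) x"
  then obtain D D' where sub: "{#D, D'#} \<subseteq># segs w" and l: "linked D D'"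
    and x: "x = segs w - {#D, D'#} + {#D \<union> D'#} + (if D \<inter> D' = {} then {#} else {#D \<inter> D'#})"
    unfolding elementary_op_def by auto
  have "D \<in># segs w" "D' \<in># segs w" using mset_subset_eqD[OF sub] by auto
  then obtain i j where i: "i \<in> {1..n}" "D = {b i..e (w i)}"
    and j: "j \<in> {1..n}" "D' = {b j..e (w j)}" by (auto simp: segs_def)
  \<comment> \<open>Linked segments are distinct, so no count of multiplicities is needed to
    separate the indices.\<close>
  have "i \<noteq> j" using l i j by (auto simp: linked_def)
  then consider "i < j" | "j < i" by linarith
  then show "\<exists>v. bruhat_step n w v \<and> x = segs v"
  proof cases
    case 1
    with l i j w have "w i < w j" using linked_iff by simp
    with 1 i j w have "bruhat_step n w (w \<circ> transpose i j)"
      unfolding bruhat_step_iff[OF w] by auto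
    with 1 i j w x \<open>w i < w j\<close> show ?thesis
      using segs_exchange[of w i j] by blast
  next
    case 2
    with l i j w have "w j < w i" using linked_iff[OF w, of j i] linked_sym by blast
    with 2 i j w have step: "bruhat_step n w (w \<circ> transpose j i)"
      unfolding bruhat_step_iff[OF w] by auto
    \<comment> \<open>The operation is symmetric in its two segments, so the one with the smaller
      begin may be named first.\<close>
    have "x = segs w - {#D', D#} + {#D' \<union> D#} + (if D' \<inter> D = {} then {#} else {#D' \<inter> D#})"
      unfolding x by (simp only: Un_commute Int_commute add_mset_commute)
    with 2 i j w step \<open>w j < w i\<close> show ?thesis
      using segs_exchange[of w j i] by blast
  qed
next
  assume "\<exists>v. bruhat_step n w v \<and> x = segs v"
  then obtain i j where ij: "i \<in> {1..n}" "j \<in> {1..n}" "i < j" "w i < w j"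
    and x: "x = segs (w \<circ> transpose i j)"
    using bruhat_step_iff[OF w] by auto
  have "{#{b i..e (w i)}, {b j..e (w j)}#} \<subseteq># segs w"
    using segs_split[of i j w] ij by simp
  with ij w x show "elementary_op (segs w) x"
    unfolding elementary_op_def using linked_iff segs_exchange by metis
qed

text \<open>Every multisegment reached from \<open>segs w\<close> is again some
  \<open>segs v\<close> with \<open>v\<close> a permutation, so the correspondence of single steps
  can be iterated.\<close>

lemma elementary_ops_segs_iff:
  assumes w: "w permutes {1..n}"
  shows "elementary_op\<^sup>*\<^sup>* (segs w) x \<longleftrightarrow> (\<exists>v. bruhat_le n w v \<and> x = segs v)"
proof
  assume "elementary_op\<^sup>*\<^sup>* (segs w) x"
  then show "\<exists>v. bruhat_le n w v \<and> x = segs v"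
  proof (induction rule: rtranclp_induct)
    case base
    then show ?case by (auto simp: bruhat_le_def)
  next
    case (step y z)
    then obtain v where v: "bruhat_le n w v" "y = segs v" by blast
    with w have "v permutes {1..n}" using bruhat_le_permutes by blast
    then obtain v' where "bruhat_step n v v'" "z = segs v'"
      using step.hyps v elementary_op_segs_iff[of v z] by auto
    with v show ?case unfolding bruhat_le_def by (blast intro: rtranclp.rtrancl_into_rtrancl)
  qed
next
  assume "\<exists>v. bruhat_le n w v \<and> x = segs v"
  then obtain v where "bruhat_le n w v" and x: "x = segs v" by auto
  then have "(bruhat_step n)\<^sup>*\<^sup>* w v" by (simp add: bruhat_le_def)
  then have "elementary_op\<^sup>*\<^sup>* (segs w) (segs v)"
  proof (induction rule: rtranclp_induct)
    case base
    then show ?case by simp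
  next
    case (step y z)
    then have "y permutes {1..n}" by (simp add: bruhat_step_def)
    then have "elementary_op (segs y) (segs z)"
      using step.hyps elementary_op_segs_iff by auto
    with step.IH show ?case by simp
  qed
  with x show "elementary_op\<^sup>*\<^sup>* (segs w) x" by simp
qed

text \<open>Begins are distinct, so the segment beginning at \<open>b i\<close> reveals
  \<open>i\<close>, and its end then reveals \<open>w i\<close>.\<close>

lemma inj_on_segs: "inj_on segs {w. w permutes {1..n}}"
proof (rule inj_onI)
  fix w v
  assume "w \<in> {w. w permutes {1..n}}" "v \<in> {w. w permutes {1..n}}" and eq: "segs w = segs v"
  then have w: "w permutes {1..n}" and v: "v permutes {1..n}" by auto
  have "w i = v i" if i: "i \<in> {1..n}" for i
  proof -
    have wi: "w i \<in> {1..n}" using w i permutes_in_image by metis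
    have "{b i..e (w i)} \<in># segs v" unfolding eq[symmetric] using i by (auto simp: segs_def)
    then obtain j where j: "j \<in> {1..n}" "{b i..e (w i)} = {b j..e (v j)}"
      by (auto simp: segs_def)
    \<comment> \<open>Equal intervals have equal ends only when they are nonempty.\<close>
    moreover have "b i \<le> e (w i)" using b_le_e i wi by blast
    ultimately have "b i = b j" "e (w i) = e (v j)" by auto
    moreover have "v j \<in> {1..n}" using v j permutes_in_image by metis
    ultimately show ?thesis
      using strict_mono_on_eqD[OF strict_mono_b] strict_mono_on_eqD[OF strict_mono_e] i j wi
      by metis
  qed
  then show "w = v" using permutes_not_in[OF w] permutes_not_in[OF v] by (intro ext) metis
qed

text \<open>What lies below \<open>segs id\<close> is the image of the permutations above
  \<open>id\<close> in the Bruhat order, and these are all permutations.\<close>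

lemma bij_betw_segs: "bij_betw segs {w. w permutes {1..n}} (mseg_below (segs id))"
proof -
  have "mseg_below (segs id) = segs ` {w. bruhat_le n id w}"
    using elementary_ops_segs_iff[OF permutes_id] by (auto simp: mseg_below_def mseg_le_def)
  also have "{w. bruhat_le n id w} = {w. w permutes {1..n}}"
    using bruhat_le_id bruhat_le_permutes permutes_id by blast
  finally show ?thesis using inj_on_segs unfolding bij_betw_def by blast
qed

text \<open>Injectivity of \<open>segs\<close> identifies the permutation reached by the elementary
  operations with \<open>v\<close> itself.\<close>

lemma bruhat_le_iff_mseg_le:
  assumes "w permutes {1..n}" "v permutes {1..n}"
  shows "bruhat_le n w v \<longleftrightarrow> mseg_le (segs v) (segs w)"
proof -
  have "segs v = segs v' \<longleftrightarrow> v = v'" if "bruhat_le n w v'" for v'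
    using inj_on_eq_iff[OF inj_on_segs, of v v'] assms bruhat_le_permutes[OF that] by simp
  then show ?thesis
    by (simp add: mseg_le_def elementary_ops_segs_iff[OF assms(1)] cong: conj_cong)
qed

end

section \<open>From segments as sets to their ends\<close>

lemma is_segment_eq: "is_segment D \<Longrightarrow> D = {seg_begin D..seg_end D}"
proof -
  assume "is_segment D"
  then obtain i j where "i \<le> j" "D = {i..j}" unfolding is_segment_def by blast
  moreover from this have "Min D = i" "Max D = j" by (auto intro!: Min_eqI Max_eqI)
  ultimately show ?thesis by (simp add: seg_begin_def seg_end_def)
qed

lemma sum_singleton_eq_image_mset:
  "finite A \<Longrightarrow> (\<Sum>i\<in>A. {#f i#}) = image_mset f (mset_set A)"
  by (induction A rule: finite_induct) auto

theorem proposition4p7: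
  fixes n :: nat and \<Delta> :: "nat \<Rightarrow> int set"
  assumes "symmetric_mseg (mseg_of n \<Delta>)"
    and "strict_mono_on {1..n} (\<lambda>i. seg_begin (\<Delta> i))"
    and "strict_mono_on {1..n} (\<lambda>i. seg_end (\<Delta> i))"
  shows "bij_betw (Phi n \<Delta>) {w. w permutes {1..n}} (mseg_below (mseg_of n \<Delta>)) \<and>
    (\<forall>w v. w permutes {1..n} \<longrightarrow> v permutes {1..n} \<longrightarrow>
      (bruhat_le n w v \<longleftrightarrow> mseg_le (Phi n \<Delta> v) (Phi n \<Delta> w)))"
proof -
  let ?b = "\<lambda>i. seg_begin (\<Delta> i)" and ?e = "\<lambda>i. seg_end (\<Delta> i)"
  have mseg: "mseg_of n \<Delta> = image_mset \<Delta> (mset_set {1..n})"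
    by (simp add: mseg_of_def sum_singleton_eq_image_mset)
  have le: "?b i \<le> ?e j" if "i \<in> {1..n}" "j \<in> {1..n}" for i j
  proof -
    have "?b i \<le> Max (seg_begin ` set_mset (mseg_of n \<Delta>))"
      using that by (intro Max_ge) (auto simp: mseg)
    \<comment> \<open>The index \<open>i\<close> makes the multisegment nonempty, which discharges
      the guard in \<open>symmetric_mseg\<close>; for \<open>n = 0\<close> the claim is
      vacuous.\<close>
    also have "\<dots> \<le> Min (seg_end ` set_mset (mseg_of n \<Delta>))"
      using assms(1) that unfolding symmetric_mseg_def by (auto simp: mseg mset_set_empty_iff)
    also have "\<dots> \<le> ?e j"
      using that by (intro Min_le) (auto simp: mseg)
    finally show ?thesis .
  qed
  interpret symmetric_family n ?b ?e
    using assms le by unfold_locales auto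
  have Phi: "Phi n \<Delta> = segs"
    by (rule ext) (simp add: Phi_def segs_def sum_singleton_eq_image_mset)
  have "\<Delta> i = {?b i..?e i}" if "i \<in> {1..n}" for i
    using assms(1) that
    by (intro is_segment_eq) (auto simp: symmetric_mseg_def is_multisegment_def mseg)
  then have "mseg_of n \<Delta> = segs id"
    unfolding mseg segs_def by (intro image_mset_cong) auto
  then show ?thesis
    using bij_betw_segs bruhat_le_iff_mseg_le by (simp add: Phi)
qed

end
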